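(* For any $f\in\mathbb C[x_1,\dots,x_6]$ and any $h\in\mathcal C$ we have $\{f,h\}_\Omega=0$. In particular, $\{f,H_1\}_\Omega=\{f,H_2\}_\Omega=0$ for any $f\in\mathbb C[x_1,\dots,x_6]$.
   Context: Consider $\mathbb C^6$ with coordinates $x=(x_1,\dots,x_6)$, volume form $dV=dx_1\wedge dx_2\wedge dx_3\wedge dx_4\wedge dx_5\wedge dx_6$, and the differential 4-form (writing $dx_{ijkl}=dx_i\wedge dx_j\wedge dx_k\wedge dx_l$) $$\begin{aligned}\Omega=\ &x_1x_3\,dx_{2456}+x_1x_4\,dx_{2356}-x_1x_5\,dx_{2346}-x_1x_6\,dx_{2345}\\&+x_2x_3\,dx_{1456}+x_2x_4\,dx_{1356}-x_2x_5\,dx_{1346}-x_2x_6\,dx_{1345}\\&+x_3x_5\,dx_{1246}+x_3x_6\,dx_{1245}+x_4x_5\,dx_{1236}+x_4x_6\,dx_{1235}.\end{aligned}$$ The Poisson bracket is $\{f_1,f_2\}_\Omega=\dfrac{\Omega\wedge df_1\wedge df_2}{dV}$. The Casimir subalgebra $\mathcal C\subset\mathbb C[x_1,\dots,x_6]$ is the subalgebra generated by $h_1=x_1x_2$, $h_2=x_3x_4$, $h_3=x_5x_6$, $h_4=x_1x_3x_5$, $h_5=x_2x_4x_6$. Also $H_1=x_1x_2+x_3x_4+x_5x_6-x_1x_3x_5$ and $H_2=x_1x_2+x_3x_4+x_5x_6-x_2x_4x_6$. *)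

theory Defs
  imports
    Complex_Main
    "HOL-Library.Poly_Mapping"
    "HOL-Library.Numeral_Type"
    "HOL-Analysis.Finite_Cartesian_Product"
    "HOL-Analysis.Cartesian_Space"
begin

text \<open>
  The six coordinates are indexed by the six-element type \<^typ>\<open>6\<close>, whose elements are the
  numerals 1, ..., 6 (with 6 = 0). An element of \<open>\<complex>[x\<^sub>1,\<dots>,x\<^sub>6]\<close> is a finitely supported map
  from exponent vectors to coefficients, with the convolution product of the library.
\<close>

type_synonym poly6 = "(6 \<Rightarrow>\<^sub>0 nat) \<Rightarrow>\<^sub>0 complex"

definition X :: "6 \<Rightarrow> poly6" where
  "X i = Poly_Mapping.single (Poly_Mapping.single i 1) 1"

definition Const :: "complex \<Rightarrow> poly6" where
  "Const c = Poly_Mapping.single 0 c"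

text \<open>
  In the summand for the monomial \<open>m\<close>, the truncated subtraction in the exponent is harmless:
  if \<open>x\<^sub>i\<close> does not occur in \<open>m\<close>, then the coefficient is 0.
\<close>

definition partial :: "6 \<Rightarrow> poly6 \<Rightarrow> poly6" where
  "partial i p = (\<Sum>m\<in>Poly_Mapping.keys p.
     Poly_Mapping.single (m - Poly_Mapping.single i 1)
       (of_nat (Poly_Mapping.lookup m i) * Poly_Mapping.lookup p m))"

text \<open>
  Polynomial differential forms (of mixed degree) form the free module over the polynomial ring
  with a basis indexed by the sets \<open>I\<close> of indices; the basis element of \<open>I\<close> is the wedge product
  of the \<open>dx\<^sub>i\<close>, \<open>i \<in> I\<close>, in the increasing order of the type \<^typ>\<open>6\<close>. In that order 6 = 0 is the
  least element. This affects only the choice of the basis elements' signs: the forms below are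
  all written as wedge products of the \<open>dx\<^sub>i\<close> in an explicitly given order.
\<close>

type_synonym form6 = "poly6 ^ (6 set)"

text \<open>The sign of the permutation that sorts \<open>I\<close> followed by \<open>J\<close>, for disjoint \<open>I\<close> and \<open>J\<close>.\<close>

definition shuffle_sign :: "6 set \<Rightarrow> 6 set \<Rightarrow> poly6" where
  "shuffle_sign I J = (- 1) ^ card {(i, j). i \<in> I \<and> j \<in> J \<and> j < i}"

definition wedge :: "form6 \<Rightarrow> form6 \<Rightarrow> form6"  (infixr \<open>\<^bold>\<and>\<close> 70) where
  "\<alpha> \<^bold>\<and> \<beta> = (\<chi> K. \<Sum>I\<in>Pow K. shuffle_sign I (K - I) * (\<alpha> $ I) * (\<beta> $ (K - I)))"

definition dx :: "6 \<Rightarrow> form6" where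
  "dx i = axis {i} 1"

text \<open>\<open>dxs [i, j, \<dots>] = dx\<^sub>i \<and> dx\<^sub>j \<and> \<dots>\<close>; the empty product \<open>axis {} 1\<close> is the 0-form 1.\<close>

definition dxs :: "6 list \<Rightarrow> form6" where
  "dxs is = foldr (\<lambda>i \<omega>. dx i \<^bold>\<and> \<omega>) is (axis {} 1)"

definition d :: "poly6 \<Rightarrow> form6" where
  "d f = (\<Sum>i\<in>UNIV. partial i f *s dx i)"

definition dV :: form6 where
  "dV = dxs [1, 2, 3, 4, 5, 6]"

definition \<Omega> :: form6 where
  "\<Omega> =
     (X 1 * X 3) *s dxs [2, 4, 5, 6] + (X 1 * X 4) *s dxs [2, 3, 5, 6]
   - (X 1 * X 5) *s dxs [2, 3, 4, 6] - (X 1 * X 6) *s dxs [2, 3, 4, 5]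
   + (X 2 * X 3) *s dxs [1, 4, 5, 6] + (X 2 * X 4) *s dxs [1, 3, 5, 6]
   - (X 2 * X 5) *s dxs [1, 3, 4, 6] - (X 2 * X 6) *s dxs [1, 3, 4, 5]
   + (X 3 * X 5) *s dxs [1, 2, 4, 6] + (X 3 * X 6) *s dxs [1, 2, 4, 5]
   + (X 4 * X 5) *s dxs [1, 2, 3, 6] + (X 4 * X 6) *s dxs [1, 2, 3, 5]"

text \<open>
  The quotient of a form of degree 6 by \<open>dV\<close> is the unique polynomial \<open>g\<close> such that the form
  is \<open>g dV\<close>.
\<close>

definition bracket :: "poly6 \<Rightarrow> poly6 \<Rightarrow> poly6" where
  "bracket f g = (THE q. \<Omega> \<^bold>\<and> d f \<^bold>\<and> d g = q *s dV)"

inductive_set subalgebra_generated :: "poly6 set \<Rightarrow> poly6 set" for S where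
  gen: "p \<in> S \<Longrightarrow> p \<in> subalgebra_generated S"
| const: "Const c \<in> subalgebra_generated S"
| add: "p \<in> subalgebra_generated S \<Longrightarrow> q \<in> subalgebra_generated S \<Longrightarrow>
    p + q \<in> subalgebra_generated S"
| mult: "p \<in> subalgebra_generated S \<Longrightarrow> q \<in> subalgebra_generated S \<Longrightarrow>
    p * q \<in> subalgebra_generated S"

definition Casimir :: "poly6 set" where
  "Casimir = subalgebra_generated {X 1 * X 2, X 3 * X 4, X 5 * X 6, X 1 * X 3 * X 5, X 2 * X 4 * X 6}"

definition H1 :: poly6 where
  "H1 = X 1 * X 2 + X 3 * X 4 + X 5 * X 6 - X 1 * X 3 * X 5"

definition H2 :: poly6 where
  "H2 = X 1 * X 2 + X 3 * X 4 + X 5 * X 6 - X 2 * X 4 * X 6"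

end

theory Submission
  imports Defs
begin

text \<open>
  The Casimir generators are the first integrals from which \<open>\<Omega>\<close> is built: expanding the product
  gives
  \<open>dh\<^sub>1 \<and> dh\<^sub>2 \<and> dh\<^sub>3 \<and> dh\<^sub>4 = - x\<^sub>1x\<^sub>3x\<^sub>5 \<Omega>\<close>. A repeated factor kills a wedge product,
  so \<open>\<Omega> \<and> dh\<^sub>i = 0\<close> for \<open>i \<le> 4\<close>; the relation \<open>h\<^sub>1h\<^sub>2h\<^sub>3 = h\<^sub>4h\<^sub>5\<close> expresses \<open>h\<^sub>4 dh\<^sub>5\<close> through the
  other four differentials and gives the same for \<open>h\<^sub>5\<close>. This explains the five equations
  \<open>\<Omega> \<and> dh\<^sub>i = 0\<close>, up to cancelling \<open>x\<^sub>1x\<^sub>3x\<^sub>5\<close> and \<open>h\<^sub>4\<close>. Expanding each of them in the basis of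
  5-forms verifies them without any cancellation of factors (\<open>Omega_wedge_d_generator\<close>).

  The rest is formal. By the Leibniz rule \<open>d_mult\<close>, the polynomials \<open>h\<close> with \<open>\<Omega> \<and> dh = 0\<close> form
  a subalgebra, which therefore contains the whole Casimir algebra, and in it \<open>H\<^sub>1\<close> and \<open>H\<^sub>2\<close>. For
  such \<open>h\<close> associativity and anticommutativity give
  \<open>\<Omega> \<and> df \<and> dh = - (\<Omega> \<and> dh) \<and> df = 0\<close>, and as \<open>dV\<close> is a basis element up to sign, the
  quotient by \<open>dV\<close> is 0.
\<close>

section \<open>The exterior algebra\<close>

lemma wedge_nth: "(\<alpha> \<^bold>\<and> \<beta>) $ K = (\<Sum>I\<in>Pow K. shuffle_sign I (K - I) * \<alpha> $ I * \<beta> $ (K - I))"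
  by (simp add: wedge_def)

lemma wedge_add_left: "(\<alpha> + \<beta>) \<^bold>\<and> \<gamma> = \<alpha> \<^bold>\<and> \<gamma> + \<beta> \<^bold>\<and> \<gamma>"
  by (simp add: vec_eq_iff wedge_nth distrib_left distrib_right sum.distrib)

lemma wedge_add_right: "\<alpha> \<^bold>\<and> (\<beta> + \<gamma>) = \<alpha> \<^bold>\<and> \<beta> + \<alpha> \<^bold>\<and> \<gamma>"
  by (simp add: vec_eq_iff wedge_nth distrib_left sum.distrib)

lemma wedge_smult_left: "(c *s \<alpha>) \<^bold>\<and> \<beta> = c *s (\<alpha> \<^bold>\<and> \<beta>)"
  by (simp add: vec_eq_iff wedge_nth sum_distrib_left mult_ac)

lemma wedge_smult_right: "\<alpha> \<^bold>\<and> (c *s \<beta>) = c *s (\<alpha> \<^bold>\<and> \<beta>)"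
  by (simp add: vec_eq_iff wedge_nth sum_distrib_left mult_ac)

lemma wedge_minus_left: "(- \<alpha>) \<^bold>\<and> \<beta> = - (\<alpha> \<^bold>\<and> \<beta>)"
  using wedge_smult_left[of "-1"] by (simp add: vector_sneg_minus1 [symmetric])

lemma wedge_minus_right: "\<alpha> \<^bold>\<and> (- \<beta>) = - (\<alpha> \<^bold>\<and> \<beta>)"
  using wedge_smult_right[of _ "-1"] by (simp add: vector_sneg_minus1 [symmetric])

lemma wedge_diff_left: "(\<alpha> - \<beta>) \<^bold>\<and> \<gamma> = \<alpha> \<^bold>\<and> \<gamma> - \<beta> \<^bold>\<and> \<gamma>"
  using wedge_add_left[of \<alpha> "- \<beta>"] by (simp add: wedge_minus_left)

lemma wedge_zero_left [simp]: "0 \<^bold>\<and> \<alpha> = 0"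
  by (simp add: vec_eq_iff wedge_nth)

lemma wedge_zero_right [simp]: "\<alpha> \<^bold>\<and> 0 = 0"
  by (simp add: vec_eq_iff wedge_nth)

lemma wedge_sum_left: "(\<Sum>i\<in>A. \<alpha> i) \<^bold>\<and> \<beta> = (\<Sum>i\<in>A. \<alpha> i \<^bold>\<and> \<beta>)"
  by (induction A rule: infinite_finite_induct) (simp_all add: wedge_add_left)

lemma wedge_sum_right: "\<alpha> \<^bold>\<and> (\<Sum>i\<in>A. \<beta> i) = (\<Sum>i\<in>A. \<alpha> \<^bold>\<and> \<beta> i)"
  by (induction A rule: infinite_finite_induct) (simp_all add: wedge_add_right)

lemma shuffle_sign_empty [simp]: "shuffle_sign {} J = 1" "shuffle_sign I {} = 1"
  by (simp_all add: shuffle_sign_def)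

lemma shuffle_sign_square: "shuffle_sign I J * shuffle_sign I J = 1"
  by (simp add: shuffle_sign_def flip: power_add)

lemma shuffle_sign_Un_left:
  assumes "I \<inter> J = {}"
  shows "shuffle_sign (I \<union> J) K = shuffle_sign I K * shuffle_sign J K"
proof -
  have "{(i, j). i \<in> I \<union> J \<and> j \<in> K \<and> j < i}
      = {(i, j). i \<in> I \<and> j \<in> K \<and> j < i} \<union> {(i, j). i \<in> J \<and> j \<in> K \<and> j < i}" by blast
  then have "card {(i, j). i \<in> I \<union> J \<and> j \<in> K \<and> j < i}
      = card {(i, j). i \<in> I \<and> j \<in> K \<and> j < i} + card {(i, j). i \<in> J \<and> j \<in> K \<and> j < i}"
    using assms by (auto intro: card_Un_disjoint)
  then show ?thesis by (simp add: shuffle_sign_def power_add)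
qed

lemma shuffle_sign_Un_right:
  assumes "J \<inter> K = {}"
  shows "shuffle_sign I (J \<union> K) = shuffle_sign I J * shuffle_sign I K"
proof -
  have "{(i, j). i \<in> I \<and> j \<in> J \<union> K \<and> j < i}
      = {(i, j). i \<in> I \<and> j \<in> J \<and> j < i} \<union> {(i, j). i \<in> I \<and> j \<in> K \<and> j < i}" by blast
  then have "card {(i, j). i \<in> I \<and> j \<in> J \<union> K \<and> j < i}
      = card {(i, j). i \<in> I \<and> j \<in> J \<and> j < i} + card {(i, j). i \<in> I \<and> j \<in> K \<and> j < i}"
    using assms by (auto intro: card_Un_disjoint)
  then show ?thesis by (simp add: shuffle_sign_def power_add)
qed

text \<open>
  Both sides at \<open>K\<close> are sums over the ordered partitions of \<open>K\<close> into three parts. The left side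
  lists them as \<open>I \<subseteq> U \<subseteq> K\<close>, the right side as \<open>I \<subseteq> K\<close> and \<open>J \<subseteq> K - I\<close>, with \<open>J = U - I\<close>. The
  signs agree because each of them counts the inversions between the three pairs of parts.
\<close>

lemma wedge_assoc: "(\<alpha> \<^bold>\<and> \<beta>) \<^bold>\<and> \<gamma> = \<alpha> \<^bold>\<and> (\<beta> \<^bold>\<and> \<gamma>)"
proof -
  have "((\<alpha> \<^bold>\<and> \<beta>) \<^bold>\<and> \<gamma>) $ K = (\<alpha> \<^bold>\<and> (\<beta> \<^bold>\<and> \<gamma>)) $ K" for K
  proof -
    let ?s = shuffle_sign
    have "((\<alpha> \<^bold>\<and> \<beta>) \<^bold>\<and> \<gamma>) $ K = (\<Sum>(U, I)\<in>(SIGMA U:Pow K. Pow U).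
        ?s U (K - U) * ?s I (U - I) * (\<alpha> $ I * \<beta> $ (U - I) * \<gamma> $ (K - U)))"
      by (simp add: wedge_nth sum_distrib_left sum_distrib_right sum.Sigma mult_ac)
    also have "\<dots> = (\<Sum>(I, J)\<in>(SIGMA I:Pow K. Pow (K - I)).
        ?s I (K - I) * ?s J (K - I - J) * (\<alpha> $ I * \<beta> $ J * \<gamma> $ (K - I - J)))"
    proof (rule sum.reindex_bij_witness
        [where i = "\<lambda>(I, J). (I \<union> J, I)" and j = "\<lambda>(U, I). (I, U - I)"], goal_cases)
      case (5 p)
      obtain U I where p: "p = (U, I)" by (cases p)
      with 5 have sub: "I \<subseteq> U" "U \<subseteq> K" by auto
      have U: "U = I \<union> (U - I)" and KI: "K - I = (U - I) \<union> (K - U)" and KU: "K - I - (U - I) = K - U"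
        using sub by auto
      have "?s U (K - U) = ?s I (K - U) * ?s (U - I) (K - U)"
        by (subst U, rule shuffle_sign_Un_left) auto
      moreover have "?s I (K - I) = ?s I (U - I) * ?s I (K - U)"
        by (subst KI, rule shuffle_sign_Un_right) auto
      ultimately show ?case by (simp add: p KU mult_ac)
    qed auto
    also have "\<dots> = (\<alpha> \<^bold>\<and> (\<beta> \<^bold>\<and> \<gamma>)) $ K"
      by (simp add: wedge_nth sum_distrib_left sum.Sigma mult_ac)
    finally show ?thesis .
  qed
  then show ?thesis by (simp add: vec_eq_iff)
qed

lemma wedge_axis_axis:
  assumes "I \<inter> J = {}"
  shows "axis I a \<^bold>\<and> axis J b = (shuffle_sign I J * a * b) *s axis (I \<union> J) 1"
proof -
  have "(axis I a \<^bold>\<and> axis J b) $ K = ((shuffle_sign I J * a * b) *s axis (I \<union> J) 1) $ K" for K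
  proof -
    have "(axis I a \<^bold>\<and> axis J b) $ K
        = (\<Sum>L\<in>Pow K. if L = I then if K - I = J then shuffle_sign I J * a * b else 0 else 0)"
      unfolding wedge_nth axis_def by (intro sum.cong) auto
    also have "\<dots> = ((shuffle_sign I J * a * b) *s axis (I \<union> J) 1) $ K"
      using assms by (auto simp: axis_def)
    finally show ?thesis .
  qed
  then show ?thesis by (simp add: vec_eq_iff)
qed

lemma wedge_one_left [simp]: "axis {} 1 \<^bold>\<and> \<alpha> = \<alpha>"
proof -
  have "(axis {} 1 \<^bold>\<and> \<alpha>) $ K = (\<Sum>I\<in>Pow K. if I = {} then \<alpha> $ K else 0)" for K
    unfolding wedge_nth axis_def by (intro sum.cong) auto
  then show ?thesis by (simp add: vec_eq_iff)
qed

lemma wedge_one_right [simp]: "\<alpha> \<^bold>\<and> axis {} 1 = \<alpha>"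
proof -
  have "(\<alpha> \<^bold>\<and> axis {} 1) $ K = (\<Sum>I\<in>Pow K. if I = K then \<alpha> $ K else 0)" for K
    unfolding wedge_nth axis_def by (intro sum.cong) auto
  then show ?thesis by (simp add: vec_eq_iff)
qed

lemma dx_wedge_self [simp]: "dx i \<^bold>\<and> dx i = 0"
proof -
  have "(dx i \<^bold>\<and> dx i) $ K = 0" for K
    unfolding wedge_nth dx_def axis_def by (intro sum.neutral) auto
  then show ?thesis by (simp add: vec_eq_iff)
qed

text \<open>
  For \<open>k \<noteq> l\<close>, the shuffle sign of the singletons \<open>{k}\<close>, \<open>{l}\<close> is -1 in exactly one of the two orders.
\<close>

lemma dx_wedge_dx_swap: "dx j \<^bold>\<and> dx i = - (dx i \<^bold>\<and> dx j)"
proof -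
  have sing: "shuffle_sign {k} {l} = (if l < k then - 1 else 1)" for k l :: 6
  proof -
    have "{(i, j). i \<in> {k} \<and> j \<in> {l} \<and> j < i} = (if l < k then {(k, l)} else {})" by auto
    then show ?thesis by (simp add: shuffle_sign_def)
  qed
  show ?thesis
  proof (cases "i = j")
    case False
    then show ?thesis
      by (auto simp: dx_def wedge_axis_axis sing insert_commute vector_smult_lneg)
  qed simp
qed

lemma dx_wedge_self_left [simp]: "dx i \<^bold>\<and> dx i \<^bold>\<and> \<omega> = 0"
  by (simp flip: wedge_assoc)

lemma dx_wedge_dx_swap_left: "dx j \<^bold>\<and> dx i \<^bold>\<and> \<omega> = - (dx i \<^bold>\<and> dx j \<^bold>\<and> \<omega>)"
  by (metis dx_wedge_dx_swap wedge_assoc wedge_minus_left)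

lemma smult_sum_right: "c *s (\<Sum>i\<in>A. \<alpha> i) = (\<Sum>i\<in>A. c *s \<alpha> i)"
  for \<alpha> :: "'i \<Rightarrow> 'a::comm_ring_1 ^ 'n"
  by (simp add: vec_eq_iff sum_distrib_left)

lemma dx_wedge_d_swap: "dx j \<^bold>\<and> d f = - (d f \<^bold>\<and> dx j)"
proof -
  have "dx j \<^bold>\<and> d f = (\<Sum>i\<in>UNIV. partial i f *s (dx j \<^bold>\<and> dx i))"
    by (simp add: d_def wedge_sum_right wedge_smult_right)
  also have "\<dots> = (\<Sum>i\<in>UNIV. partial i f *s - (dx i \<^bold>\<and> dx j))"
    by (simp only: dx_wedge_dx_swap[of j])
  also have "\<dots> = - (d f \<^bold>\<and> dx j)"
    by (simp add: d_def wedge_sum_left wedge_smult_left vector_smult_rneg sum_negf)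
  finally show ?thesis .
qed

lemma d_wedge_d_swap: "d f \<^bold>\<and> d g = - (d g \<^bold>\<and> d f)"
proof -
  have "d f \<^bold>\<and> d g = (\<Sum>i\<in>UNIV. partial i f *s (dx i \<^bold>\<and> d g))"
    by (simp add: d_def[of f] wedge_sum_left wedge_smult_left)
  also have "\<dots> = - (d g \<^bold>\<and> d f)"
    by (simp add: d_def[of f] dx_wedge_d_swap wedge_sum_right wedge_smult_right
        vector_smult_rneg sum_negf)
  finally show ?thesis .
qed

text \<open>
  The sorting sign is left implicit as a square root of 1: all that matters below is that it is
  invertible.
\<close>

lemma dxs_distinct:
  assumes "distinct is"
  shows "\<exists>s. s * s = 1 \<and> dxs is = s *s axis (set is) 1"
  using assms
proof (induction "is")
  case Nil
  show ?case by (rule exI[of _ 1]) (simp add: dxs_def)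
next
  case (Cons i "is")
  then obtain s where s: "s * s = 1" "dxs is = s *s axis (set is) 1" by auto
  let ?t = "shuffle_sign {i} (set is)"
  have "dxs (i # is) = (s * ?t) *s axis (set (i # is)) 1"
    using s(2) Cons.prems
    by (simp add: dxs_def dx_def wedge_smult_right wedge_axis_axis vector_smult_assoc)
  moreover have "(s * ?t) * (s * ?t) = (s * s) * (?t * ?t)" by (simp only: mult_ac)
  ultimately show ?case using s(1) by (auto simp: shuffle_sign_square)
qed

text \<open>
  This gives the uniqueness of the quotient by \<open>dV\<close> in the definition of the bracket.
\<close>

lemma smult_dV_eq_0_iff: "q *s dV = 0 \<longleftrightarrow> q = 0"
proof
  assume q: "q *s dV = 0"
  \<comment> \<open>Six distinct indices exhaust the index type, so \<open>dV\<close> sits at the top index set.\<close>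
  have dist: "distinct [1, 2, 3, 4, 5, 6 :: 6]" by simp
  have "card (set [1, 2, 3, 4, 5, 6 :: 6]) = CARD(6)"
    using distinct_card[OF dist] by simp
  then have "set [1, 2, 3, 4, 5, 6 :: 6] = UNIV" by (intro card_subset_eq) simp_all
  then obtain s where s: "s * s = 1" "dV = s *s axis UNIV 1"
    using dxs_distinct[OF dist] unfolding dV_def by metis
  have "q * s = (q *s dV) $ UNIV" by (simp add: s(2))
  then have "q * s = 0" by (simp add: q)
  then have "q * (s * s) = 0" by (simp flip: mult.assoc)
  then show "q = 0" by (simp add: s(1))
qed simp

section \<open>The differential of a polynomial\<close>

text \<open>
  A sum over a fixed set of exponents, independent of the polynomial, makes additivity visible.
\<close>

lemma partial_superset:
  assumes "finite A" "Poly_Mapping.keys p \<subseteq> A"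
  shows "partial i p = (\<Sum>m\<in>A. Poly_Mapping.single (m - Poly_Mapping.single i 1)
     (of_nat (Poly_Mapping.lookup m i) * Poly_Mapping.lookup p m))"
  unfolding partial_def by (rule sum.mono_neutral_left) (use assms in \<open>auto simp: in_keys_iff\<close>)

lemma partial_add: "partial i (p + q) = partial i p + partial i q"
proof -
  let ?A = "Poly_Mapping.keys p \<union> Poly_Mapping.keys q"
  have "Poly_Mapping.keys (p + q) \<subseteq> ?A" by (rule keys_add)
  then show ?thesis
    by (simp add: partial_superset[of ?A] lookup_add distrib_left single_add sum.distrib)
qed

lemma partial_single:
  "partial i (Poly_Mapping.single m c)
    = Poly_Mapping.single (m - Poly_Mapping.single i 1) (of_nat (Poly_Mapping.lookup m i) * c)"
  by (simp add: partial_superset[of "{m}"])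

lemma partial_0 [simp]: "partial i 0 = 0"
  by (simp add: partial_def)

lemma poly_mapping_single_induct [case_names zero single add]:
  fixes p :: "'a \<Rightarrow>\<^sub>0 'b::comm_monoid_add"
  assumes "P 0" "\<And>m c. P (Poly_Mapping.single m c)"
    and "\<And>p q. P p \<Longrightarrow> P q \<Longrightarrow> P (p + q)"
  shows "P p"
proof (induction p rule: update_induct)
  case const
  show ?case by (rule assms(1))
next
  case (update f a b)
  have "Poly_Mapping.update a b f = f + Poly_Mapping.single a b"
    using update(1)
    by (intro poly_mapping_eqI) (auto simp: lookup_add lookup_update lookup_single in_keys_iff when_def)
  moreover have "P (f + Poly_Mapping.single a b)"
    by (intro assms(2,3) update(3))
  ultimately show ?case by (simp only:)
qed

text \<open>
  Both sides are biadditive, so it suffices to compare them on monomials.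
\<close>

lemma partial_mult: "partial i (p * q) = p * partial i q + q * partial i p"
proof (induction p rule: poly_mapping_single_induct)
  case (single m a)
  show ?case
  proof (induction q rule: poly_mapping_single_induct)
    case (single n b)
    \<comment> \<open>The truncated exponent \<open>k - 1\<close> can only differ from the true one when \<open>k\<close> does not
      contain \<open>x\<^sub>i\<close>, and then the coefficient vanishes.\<close>
    have shift: "Poly_Mapping.single (l + (k - Poly_Mapping.single i 1)) (of_nat (Poly_Mapping.lookup k i) * c)
        = Poly_Mapping.single (l + k - Poly_Mapping.single i 1) (of_nat (Poly_Mapping.lookup k i) * c)"
      for k l :: "6 \<Rightarrow>\<^sub>0 nat" and c :: complex
    proof (cases "Poly_Mapping.lookup k i = 0")
      case False
      then have "l + (k - Poly_Mapping.single i 1) = l + k - Poly_Mapping.single i 1"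
        by (intro poly_mapping_eqI) (auto simp: lookup_add lookup_minus lookup_single when_def)
      then show ?thesis by simp
    qed simp
    show ?case
      using shift[of m n "a * b"] shift[of n m "a * b"]
      by (simp add: mult_single partial_single lookup_add algebra_simps flip: single_add)
  next
    case (add q r)
    then show ?case by (simp only: distrib_left distrib_right partial_add) (simp add: ac_simps)
  qed simp
next
  case (add p r)
  then show ?case by (simp only: distrib_left distrib_right partial_add) (simp add: ac_simps)
qed simp

lemma d_add: "d (p + q) = d p + d q"
  by (simp add: d_def partial_add vector_sadd_rdistrib sum.distrib)

lemma d_mult: "d (p * q) = p *s d q + q *s d p"
  by (simp add: d_def partial_mult vector_sadd_rdistrib sum.distrib vector_smult_assoc
      smult_sum_right)

lemma d_Const [simp]: "d (Const c) = 0"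
  by (simp add: d_def Const_def partial_single)

lemma d_X [simp]: "d (X i) = dx i"
proof -
  have "partial j (X i) = (if j = i then 1 else 0)" for j
    by (simp add: X_def partial_single lookup_single when_def flip: single_one)
  then show ?thesis by (simp add: d_def if_distrib[of "\<lambda>c. c *s _"] cong: if_cong)
qed

section \<open>The Casimir functions\<close>

text \<open>
  Stated for general indices, the swap would rewrite back and forth. Its instances for
  \<open>j > i\<close> (as integers from 1 to 6) sort every product of the \<open>dx\<^sub>i\<close>.
\<close>

lemmas dx_sort =
  dx_wedge_dx_swap[of 2 1] dx_wedge_dx_swap[of 3 1] dx_wedge_dx_swap[of 4 1]
  dx_wedge_dx_swap[of 5 1] dx_wedge_dx_swap[of 6 1] dx_wedge_dx_swap[of 3 2]
  dx_wedge_dx_swap[of 4 2] dx_wedge_dx_swap[of 5 2] dx_wedge_dx_swap[of 6 2]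
  dx_wedge_dx_swap[of 4 3] dx_wedge_dx_swap[of 5 3] dx_wedge_dx_swap[of 6 3]
  dx_wedge_dx_swap[of 5 4] dx_wedge_dx_swap[of 6 4] dx_wedge_dx_swap[of 6 5]
  dx_wedge_dx_swap_left[of 2 1] dx_wedge_dx_swap_left[of 3 1] dx_wedge_dx_swap_left[of 4 1]
  dx_wedge_dx_swap_left[of 5 1] dx_wedge_dx_swap_left[of 6 1] dx_wedge_dx_swap_left[of 3 2]
  dx_wedge_dx_swap_left[of 4 2] dx_wedge_dx_swap_left[of 5 2] dx_wedge_dx_swap_left[of 6 2]
  dx_wedge_dx_swap_left[of 4 3] dx_wedge_dx_swap_left[of 5 3] dx_wedge_dx_swap_left[of 6 3]
  dx_wedge_dx_swap_left[of 5 4] dx_wedge_dx_swap_left[of 6 4] dx_wedge_dx_swap_left[of 6 5]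

lemmas wedge_distribs = wedge_add_left wedge_add_right wedge_diff_left wedge_minus_left
  wedge_minus_right wedge_smult_left wedge_smult_right wedge_assoc

lemma dxs_simps [simp]: "dxs [] = axis {} 1" "dxs (i # is) = dx i \<^bold>\<and> dxs is"
  by (simp_all add: dxs_def)

text \<open>
  Multiplying out and sorting the \<open>dx\<^sub>i\<close> leaves a combination of 5-forms \<open>dx\<^sub>i\<^sub>j\<^sub>k\<^sub>l\<^sub>m\<close> with
  monomial coefficients, in which the monomials cancel in pairs. For instance
  \<open>x\<^sub>1x\<^sub>3 dx\<^sub>2\<^sub>4\<^sub>5\<^sub>6 \<and> x\<^sub>2 dx\<^sub>1\<close> cancels against \<open>x\<^sub>2x\<^sub>3 dx\<^sub>1\<^sub>4\<^sub>5\<^sub>6 \<and> x\<^sub>1 dx\<^sub>2\<close>.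
\<close>

lemma Omega_wedge_d_generator:
  assumes "h \<in> {X 1 * X 2, X 3 * X 4, X 5 * X 6, X 1 * X 3 * X 5, X 2 * X 4 * X 6}"
  shows "\<Omega> \<^bold>\<and> d h = 0"
  using assms
  by (elim insertE emptyE; hypsubst;
      simp add: \<Omega>_def d_mult wedge_distribs dx_sort vector_smult_assoc vector_smult_rneg;
      simp add: vec_eq_iff algebra_simps)

lemma Omega_wedge_d_Casimir: "h \<in> Casimir \<Longrightarrow> \<Omega> \<^bold>\<and> d h = 0"
  unfolding Casimir_def
proof (induction rule: subalgebra_generated.induct)
  case (gen h)
  then show ?case by (rule Omega_wedge_d_generator)
qed (simp_all add: d_add d_mult wedge_add_right wedge_smult_right)

lemma bracket_eq_0:
  assumes "\<Omega> \<^bold>\<and> d h = 0"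
  shows "bracket f h = 0"
proof -
  have "\<Omega> \<^bold>\<and> d f \<^bold>\<and> d h = - ((\<Omega> \<^bold>\<and> d h) \<^bold>\<and> d f)"
    by (metis d_wedge_d_swap wedge_assoc wedge_minus_right)
  then have "bracket f h = (THE q. 0 = q *s dV)" by (simp add: bracket_def assms)
  also have "\<dots> = 0" using smult_dV_eq_0_iff by (metis (mono_tags, lifting) the_equality)
  finally show ?thesis .
qed

text \<open>
  The generation rules have no subtraction, but a difference is a sum with a constant multiple.
\<close>

lemma subalgebra_generated_diff:
  assumes "p \<in> subalgebra_generated S" "q \<in> subalgebra_generated S"
  shows "p - q \<in> subalgebra_generated S"
proof -
  have "p - q = p + Const (- 1) * q"
    by (simp add: Const_def single_uminus flip: single_one)
  also have "\<dots> \<in> subalgebra_generated S"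
    using assms by (intro subalgebra_generated.add subalgebra_generated.mult subalgebra_generated.const)
  finally show ?thesis .
qed

lemma H1_in_Casimir: "H1 \<in> Casimir" and H2_in_Casimir: "H2 \<in> Casimir"
  unfolding H1_def H2_def Casimir_def
  by (intro subalgebra_generated_diff subalgebra_generated.add subalgebra_generated.gen; simp)+

theorem lemma11p9:
  shows "(\<forall>f. \<forall>h\<in>Casimir. bracket f h = 0) \<and> (\<forall>f. bracket f H1 = 0 \<and> bracket f H2 = 0)"
  using bracket_eq_0 Omega_wedge_d_Casimir H1_in_Casimir H2_in_Casimir by blast

end
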